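(* Let $0<p<1$. (a) Let $\widetilde{S}^{\ast,\nabla}$ be the weighted maximal operator $$\widetilde{S}^{\ast,\nabla}F:=\sup_{n\in\mathbb{N}_+}\frac{|S_nF|}{2^{\rho(n)(1/p-1)}}.$$ Then there exists a sequence $\{f_n,\ n\in\mathbb{N}\}$ of $p$-atoms such that $$\sup_{n\in\mathbb{N}}\frac{\big\|\widetilde{S}^{\ast,\nabla}f_n\big\|_{p}}{\|f_n\|_{H_p(G)}}=\infty.$$ (b) If $\varphi:\mathbb{N}\to[1,\infty)$ is a nondecreasing function satisfying $$\limsup_{n\to\infty}\frac{2^{\rho(n)(1/p-1)}}{\varphi(n)}=\infty,$$ then there exists a sequence $\{f_n,\ n\in\mathbb{N}\}$ of $p$-atoms such that $$\sup_{n\in\mathbb{N}}\frac{\Big\|\sup_{k\in\mathbb{N}}\frac{|S_kf_n|}{\varphi(k)}\Big\|_{\text{weak-}L_p(G)}}{\|f_n\|_{H_p(G)}}=\infty.$$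
   Context: $\mathbb{N}_+$ is the set of positive integers and $\mathbb{N}=\mathbb{N}_+\cup\{0\}$. Let $Z_2=\{0,1\}$ be the cyclic group of order 2 (discrete topology, each singleton of measure $1/2$), and let $G=\prod_{k\in\mathbb{N}}Z_2$ with the product topology and the product (normalized Haar) measure $\mu$. Elements are sequences $x=(x_0,x_1,\dots)$ with $x_k\in\{0,1\}$. Put $I_0(x):=G$ and $I_n(x):=\{y\in G: y_0=x_0,\dots,y_{n-1}=x_{n-1}\}$ for $n\ge1$; these sets are the dyadic intervals. Every $n\in\mathbb{N}$ is uniquely written as $n=\sum_{j=0}^\infty n_j2^j$ with $n_j\in\{0,1\}$, only finitely many nonzero. For $n\in\mathbb{N}_+$ let $[n]:=\min\{j:n_j\ne0\}$, $|n|:=\max\{j:n_j\neq0\}$, $\rho(n):=|n|-[n]$. Rademacher functions: $r_k(x):=(-1)^{x_k}$. Walsh functions: $w_n(x):=\prod_{k=0}^\infty r_k(x)^{n_k}$, $n\in\mathbb{N}$. For $f\in L_1(G)$, $\widehat f(k):=\int_Gfw_k\,d\mu$ and $S_nf:=\sum_{k=0}^{n-1}\widehat f(k)w_k$ for $n\in\mathbb{N}_+$ (with $S_0f:=0$, the empty sum). A bounded measurable function $a$ on $G$ is called a $p$-atom if there exists a dyadic interval $I$ such that $\int_Ia\,d\mu=0$, $\|a\|_\infty\le\mu(I)^{-1/p}$ and $\operatorname{supp}(a)\subset I$. A function $f\in L_1(G)$ is identified with the martingale $(S_{2^n}f,\ n\in\mathbb{N})$ (with respect to the $\sigma$-algebras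 generated by $\{I_n(x):x\in G\}$); its martingale Hardy space quasi-norm is $\|f\|_{H_p(G)}:=\|f^*\|_p$, where $$f^*(x):=\sup_{n\in\mathbb{N}}\frac1{\mu(I_n(x))}\Big|\int_{I_n(x)}f\,d\mu\Big|=\sup_{n\in\mathbb{N}}|S_{2^n}f(x)|.$$ Quasi-norms: $\|f\|_p^p:=\int_G|f|^p\,d\mu$ and $\|f\|_{\text{weak-}L_p(G)}^p:=\sup_{\lambda>0}\lambda^p\mu(|f|>\lambda)$. *)

theory Defs
  imports "HOL-Probability.Probability" "HOL-Library.Z2"
begin

section \<open>The dyadic group and its Haar measure\<close>

type_synonym G = "nat \<Rightarrow> bit"

definition \<mu> :: "G measure" where
  "\<mu> = (\<Pi>\<^sub>M k\<in>UNIV. uniform_count_measure (UNIV :: bit set))"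

text \<open>For \<open>n = 0\<close> this is the whole group.\<close>

definition dyadic_interval :: "nat \<Rightarrow> G \<Rightarrow> G set" where
  "dyadic_interval n x = {y. \<forall>k<n. y k = x k}"

lemma finite_UNIV_bit: "finite (UNIV :: bit set)"
  by (rule finite_subset[of _ "{0, 1}"]) (auto intro: bit.exhaust)

lemma prob_space_\<mu>: "prob_space \<mu>"
  unfolding \<mu>_def
  by (intro prob_space_PiM prob_space_uniform_count_measure finite_UNIV_bit) simp

lemma space_\<mu>: "space \<mu> = UNIV"
  by (simp add: \<mu>_def space_PiM space_uniform_count_measure)


section \<open>Binary expansions and the Walsh system\<close>

text \<open>The binary digit \<open>n\<^sub>j\<close> is \<open>of_bool (bit n j)\<close>. The functions below are only
  meaningful for \<open>n > 0\<close>.\<close>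

definition lowest_bit :: "nat \<Rightarrow> nat" where
  "lowest_bit n = Min {j. bit n j}"

definition highest_bit :: "nat \<Rightarrow> nat" where
  "highest_bit n = Max {j. bit n j}"

definition \<rho> :: "nat \<Rightarrow> nat" where
  "\<rho> n = highest_bit n - lowest_bit n"

definition rademacher :: "nat \<Rightarrow> G \<Rightarrow> real" where
  "rademacher k x = (if x k = 0 then 1 else - 1)"

text \<open>Digits equal to \<open>0\<close> contribute the factor \<open>1\<close>, so the infinite product of the
  \<open>r\<^sub>k(x)\<close> raised to the power \<open>n\<^sub>k\<close> is the finite product over the nonzero digits.\<close>

definition walsh :: "nat \<Rightarrow> G \<Rightarrow> real" where
  "walsh n x = (\<Prod>k | bit n k. rademacher k x)"

definition walsh_coeff :: "(G \<Rightarrow> real) \<Rightarrow> nat \<Rightarrow> real" where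
  "walsh_coeff f k = (\<integral>x. f x * walsh k x \<partial>\<mu>)"

definition walsh_sum :: "nat \<Rightarrow> (G \<Rightarrow> real) \<Rightarrow> G \<Rightarrow> real" where
  "walsh_sum n f x = (\<Sum>k<n. walsh_coeff f k * walsh k x)"


section \<open>Quasi-norms and the Hardy space\<close>

text \<open>Powers on \<open>[0, \<infinity>]\<close> with exponent \<open>a > 0\<close>.\<close>

definition ennpowr :: "ennreal \<Rightarrow> real \<Rightarrow> ennreal" where
  "ennpowr t a = (if t = \<top> then \<top> else ennreal (enn2real t powr a))"

text \<open>Both quasi-norms take the modulus \<open>g = |f|\<close> as argument, so that they apply to maximal
  functions, which may attain the value \<open>\<infinity>\<close>.\<close>

definition Lp_norm :: "real \<Rightarrow> (G \<Rightarrow> ennreal) \<Rightarrow> ennreal" where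
  "Lp_norm p g = ennpowr (\<integral>\<^sup>+x. ennpowr (g x) p \<partial>\<mu>) (1 / p)"

definition weak_Lp_norm :: "real \<Rightarrow> (G \<Rightarrow> ennreal) \<Rightarrow> ennreal" where
  "weak_Lp_norm p g =
     ennpowr (SUP l\<in>{0::real<..}. ennreal (l powr p) * emeasure \<mu> {x \<in> space \<mu>. g x > ennreal l}) (1 / p)"

definition martingale_max :: "(G \<Rightarrow> real) \<Rightarrow> G \<Rightarrow> ennreal" where
  "martingale_max f x =
     (SUP n. ennreal (1 / measure \<mu> (dyadic_interval n x) * \<bar>LINT y:dyadic_interval n x|\<mu>. f y\<bar>))"

definition Hp_norm :: "real \<Rightarrow> (G \<Rightarrow> real) \<Rightarrow> ennreal" where
  "Hp_norm p f = Lp_norm p (martingale_max f)"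

text \<open>Quotients by \<open>Hp_norm\<close> are formed in \<open>[0, \<infinity>]\<close>. Since \<open>Hp_norm p f = 0\<close> forces \<open>f = 0\<close> almost
  everywhere, hence \<open>walsh_sum n f = 0\<close>, and \<open>0 / 0 = 0\<close>, a null atom contributes nothing to
  a supremum of such quotients.\<close>

text \<open>Dyadic intervals are closed, so it makes no difference whether the support is taken with or
  without the closure.\<close>

definition p_atom :: "real \<Rightarrow> (G \<Rightarrow> real) \<Rightarrow> bool" where
  "p_atom p a \<longleftrightarrow> a \<in> borel_measurable \<mu> \<and> bounded (range a) \<and>
     (\<exists>n x. let I = dyadic_interval n x in
        (LINT y:I|\<mu>. a y) = 0 \<and>
        esssup \<mu> (\<lambda>y. ereal \<bar>a y\<bar>) \<le> ereal (measure \<mu> I powr (- 1 / p)) \<and>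
        {y. a y \<noteq> 0} \<subseteq> I)"


section \<open>The weighted maximal operator\<close>

definition weighted_max :: "real \<Rightarrow> (G \<Rightarrow> real) \<Rightarrow> G \<Rightarrow> ennreal" where
  "weighted_max p F x =
     (SUP n\<in>{1..}. ennreal (\<bar>walsh_sum n F x\<bar> / 2 powr (real (\<rho> n) * (1 / p - 1))))"

end

theory Submission
  imports Defs
begin

text \<open>Both parts are witnessed by one family of atoms, \<open>f\<^sub>N = 2\<^bsup>N/p\<^esup> r\<^sub>N 1\<^bsub>I\<^esub>\<close>, where \<open>I\<close> is the
  dyadic interval of rank \<open>N\<close> around \<open>0\<close>. The average of \<open>f\<^sub>N\<close> over any dyadic interval that
  contains \<open>I\<close> vanishes, so the martingale maximal function is at most \<open>2\<^bsup>N/p\<^esup> 1\<^bsub>I\<^esub>\<close> and the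
  Hardy quasi-norm of \<open>f\<^sub>N\<close> is at most \<open>1\<close>. It remains to make the maximal operators large.

  The Walsh coefficients of \<open>f\<^sub>N\<close> are \<open>0\<close> below \<open>2\<^sup>N\<close> and constantly \<open>2\<^bsup>N/p - N\<^esup>\<close> on the block
  from \<open>2\<^sup>N\<close> to \<open>2\<^bsup>N+1\<^esup>\<close>. For \<open>s < N\<close> the partial sum of order \<open>2\<^sup>N + 2\<^sup>s\<close> is therefore
  \<open>2\<^bsup>N/p - N\<^esup> r\<^sub>N\<close> times the Dirichlet kernel of order \<open>2\<^sup>s\<close>, which equals \<open>2\<^sup>s\<close> on the interval of
  rank \<open>s\<close> around \<open>0\<close> (lemma \<open>abs_walsh_sum_rademacher_atom\<close>). Moreover
  \<open>\<rho> (2\<^sup>N + 2\<^sup>s) = N - s\<close>.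

  For the weight \<open>2\<^bsup>\<rho>(n)(1/p - 1)\<^esup>\<close> this shows that the maximal function is at least \<open>2\<^bsup>s/p\<^esup>\<close> on
  the interval of rank \<open>s\<close>, for every \<open>s < N\<close>. Each of the \<open>N\<close> disjoint rings between
  consecutive intervals then contributes \<open>1/2\<close> to the integral of the \<open>p\<close>-th power, and the
  \<open>L\<^sub>p\<close> quasi-norm diverges with \<open>N\<close> (lemma \<open>Lp_norm_weighted_max_ge\<close>).

  For a weight \<open>\<phi>\<close>, a single interval suffices: the weak quasi-norm is at least half of
  \<open>2\<^bsup>(N - s)(1/p - 1)\<^esup> / \<phi> (2\<^sup>N + 2\<^sup>s)\<close> (lemma \<open>weak_Lp_norm_rademacher_atom_ge\<close>). If the
  quotient \<open>2\<^bsup>\<rho>(n)(1/p - 1)\<^esup> / \<phi> n\<close> is large at \<open>n\<close>, then, as \<open>\<phi>\<close> is nondecreasing, it is at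
  least as large at the number keeping only the highest and the lowest binary digit of \<open>n\<close>
  (lemma \<open>exists_exp_add_exp_large_ratio\<close>), which has the form \<open>2\<^sup>N + 2\<^sup>s\<close>.\<close>

section \<open>Dyadic intervals and their measure\<close>

abbreviation origin_interval :: "nat \<Rightarrow> G set" where
  "origin_interval n \<equiv> dyadic_interval n (\<lambda>_. 0)"

lemma sets_uniform_count_bit [simp]:
  "sets (uniform_count_measure (UNIV :: bit set)) = UNIV"
  by (simp add: sets_uniform_count_measure)

lemma card_UNIV_bit: "card (UNIV :: bit set) = 2"
proof -
  have "(UNIV :: bit set) = {0, 1}"
    by (auto intro: bit.exhaust)
  then have "card (UNIV :: bit set) = card {0, 1 :: bit}" by (rule arg_cong)
  also have "\<dots> = 2" by simp
  finally show ?thesis .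
qed

lemma coordinate_measurable [measurable]:
  "(\<lambda>x. x k) \<in> measurable \<mu> (uniform_count_measure (UNIV :: bit set))"
  unfolding \<mu>_def by (rule measurable_component_singleton) simp

lemma rademacher_measurable [measurable]: "rademacher k \<in> borel_measurable \<mu>"
proof -
  have "(\<lambda>b :: bit. if b = 0 then 1 else - 1 :: real)
      \<in> borel_measurable (uniform_count_measure UNIV)"
    by (simp add: measurable_def)
  from measurable_compose[OF coordinate_measurable this] show ?thesis
    unfolding rademacher_def .
qed

lemma walsh_measurable [measurable]: "walsh n \<in> borel_measurable \<mu>"
  unfolding walsh_def[abs_def] by measurable

lemma walsh_sum_measurable [measurable]: "walsh_sum n f \<in> borel_measurable \<mu>"
  unfolding walsh_sum_def[abs_def] by measurable

lemma dyadic_interval_eq_Collect: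
  "dyadic_interval n x = {y \<in> space \<mu>. \<forall>k\<in>{..<n}. y k \<in> {x k}}"
  by (auto simp: dyadic_interval_def space_\<mu>)

lemma dyadic_interval_sets [measurable]: "dyadic_interval n x \<in> sets \<mu>"
proof -
  have "{y \<in> space \<mu>. y k \<in> {x k}} \<in> sets \<mu>" for k
    using measurable_sets[OF coordinate_measurable, of "{x k}" k]
    by (simp add: vimage_def Int_def conj_commute)
  then show ?thesis
    unfolding dyadic_interval_eq_Collect by (intro sets.sets_Collect_finite_All) auto
qed

lemma emeasure_dyadic_interval: "emeasure \<mu> (dyadic_interval n x) = ennreal ((1 / 2) ^ n)"
proof -
  interpret product_prob_space "\<lambda>_ :: nat. uniform_count_measure (UNIV :: bit set)" UNIV
    by (intro product_prob_spaceI prob_space_uniform_count_measure finite_UNIV_bit) simp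
  have one: "emeasure (uniform_count_measure (UNIV :: bit set)) {b} = ennreal (1 / 2)" for b
    by (subst emeasure_uniform_count_measure) (auto simp: finite_UNIV_bit card_UNIV_bit)
  have "emeasure \<mu> (dyadic_interval n x) =
      (\<Prod>k<n. emeasure (uniform_count_measure (UNIV :: bit set)) {x k})"
    unfolding dyadic_interval_eq_Collect \<mu>_def by (rule emeasure_PiM_Collect) auto
  also have "\<dots> = ennreal ((1 / 2) ^ n)"
    by (simp only: one prod_constant card_lessThan ennreal_power)
  finally show ?thesis .
qed

lemma measure_dyadic_interval: "measure \<mu> (dyadic_interval n x) = (1 / 2) ^ n"
  by (simp add: measure_def emeasure_dyadic_interval)

lemma origin_interval_antimono: "m \<le> n \<Longrightarrow> origin_interval n \<subseteq> origin_interval m"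
  by (auto simp: dyadic_interval_def)

section \<open>Binary digits and Walsh functions\<close>

lemma bit_nat_imp_less: "bit (j :: nat) i \<Longrightarrow> j < 2 ^ n \<Longrightarrow> i < n"
  by (metis bit_take_bit_iff take_bit_nat_eq_self)

lemma bit_imp_exp_le: "bit (n :: nat) j \<Longrightarrow> 2 ^ j \<le> n"
  using bit_nat_imp_less[of n j j] by (meson less_irrefl not_less)

lemma bit_exp_add_iff:
  assumes "j < 2 ^ N"
  shows "bit (2 ^ N + j :: nat) i \<longleftrightarrow> i = N \<or> bit j i"
proof -
  have "Bit_Operations.and (2 ^ N) j = (0 :: nat)"
    using bit_nat_imp_less[OF _ assms] by (intro bit_eqI) (auto simp: bit_and_iff bit_exp_iff)
  from disjunctive_add_eq_or[OF this] show ?thesis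
    by (auto simp: bit_or_iff bit_exp_iff)
qed

lemma bits_exp_add_exp: "s < N \<Longrightarrow> {j. bit (2 ^ N + 2 ^ s :: nat) j} = {s, N}"
  by (auto simp: bit_exp_add_iff bit_exp_iff)

lemma \<rho>_exp_add_exp: "s < N \<Longrightarrow> \<rho> (2 ^ N + 2 ^ s) = N - s"
  by (simp add: \<rho>_def highest_bit_def lowest_bit_def bits_exp_add_exp)

lemma finite_bits: "finite {j. bit (n :: nat) j}"
proof (rule finite_subset)
  show "{j. bit n j} \<subseteq> {..<n}"
    using bit_nat_imp_less[OF _ less_exp] by auto
qed simp

text \<open>The number \<open>\<rho> n\<close> depends on the two extreme binary digits of \<open>n\<close> only, so deleting all
  other digits preserves it. That this does not increase \<open>n\<close> is what allows nondecreasing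
  weights to be compared at the two numbers.\<close>

lemma extreme_bits_le:
  assumes "0 < \<rho> n" and "0 < n"
  shows "lowest_bit n < highest_bit n" "2 ^ highest_bit n + 2 ^ lowest_bit n \<le> n"
proof -
  let ?N = "highest_bit n" and ?s = "lowest_bit n"
  show lt: "?s < ?N" using assms(1) by (simp add: \<rho>_def)
  have "{j. bit n j} \<noteq> {}"
    using assms(2) bit_eq_iff[of n 0] by auto
  then have bits: "bit n ?N" "bit n ?s"
    using Max_in[OF finite_bits] Min_in[OF finite_bits]
    by (auto simp: highest_bit_def lowest_bit_def)
  have "2 ^ ?s \<le> n mod 2 ^ ?N"
    using bits(2) lt by (intro bit_imp_exp_le) (simp add: bit_take_bit_iff flip: take_bit_eq_mod)
  moreover have "1 \<le> n div 2 ^ ?N"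
    using bit_imp_exp_le[OF bits(1)] by (simp add: Suc_le_eq div_greater_zero_iff)
  then have "2 ^ ?N \<le> 2 ^ ?N * (n div 2 ^ ?N)" by simp
  ultimately show "2 ^ ?N + 2 ^ ?s \<le> n"
    using mult_div_mod_eq[of "2 ^ ?N" n] by linarith
qed

lemma abs_rademacher [simp]: "\<bar>rademacher k x\<bar> = 1"
  by (simp add: rademacher_def)

text \<open>A Walsh function of index below \<open>2\<^sup>n\<close> involves only the first \<open>n\<close> coordinates, which
  are \<open>0\<close> on the interval of rank \<open>n\<close>.\<close>

lemma walsh_eq_1:
  assumes "j < 2 ^ n" and "x \<in> origin_interval n"
  shows "walsh j x = 1"
  unfolding walsh_def using assms bit_nat_imp_less[OF _ assms(1)]
  by (intro prod.neutral) (auto simp: rademacher_def dyadic_interval_def)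

lemma walsh_exp_add:
  assumes "j < 2 ^ N"
  shows "walsh (2 ^ N + j) x = rademacher N x * walsh j x"
proof -
  have "{i. bit (2 ^ N + j) i} = insert N {i. bit j i}"
    using bit_exp_add_iff[OF assms] by auto
  moreover have "\<not> bit j N"
    using bit_nat_imp_less[OF _ assms, of N] by blast
  ultimately show ?thesis
    by (simp add: walsh_def finite_bits)
qed

section \<open>The extremal atoms\<close>

text \<open>Up to the factor \<open>2\<^bsup>N/p - N\<^esup>\<close> this is the difference of the Dirichlet kernels of
  orders \<open>2\<^bsup>N+1\<^esup>\<close> and \<open>2\<^sup>N\<close>. The normalisation is the largest one that a \<open>p\<close>-atom on an
  interval of measure \<open>2\<^bsup>-N\<^esup>\<close> may have.\<close>

definition rademacher_atom :: "real \<Rightarrow> nat \<Rightarrow> G \<Rightarrow> real" where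
  "rademacher_atom p N x = 2 powr (real N / p) * (rademacher N x * indicator (origin_interval N) x)"

lemma rademacher_atom_measurable [measurable]: "rademacher_atom p N \<in> borel_measurable \<mu>"
  unfolding rademacher_atom_def[abs_def] by measurable

lemma abs_rademacher_atom:
  "\<bar>rademacher_atom p N x\<bar> = 2 powr (real N / p) * indicator (origin_interval N) x"
  by (simp add: rademacher_atom_def abs_mult)

lemma abs_rademacher_atom_le: "\<bar>rademacher_atom p N x\<bar> \<le> 2 powr (real N / p)"
  by (auto simp: abs_rademacher_atom indicator_def)

lemma integral_rademacher_indicator:
  "(\<integral>x. rademacher N x * indicator (origin_interval N) x \<partial>\<mu>) = 0"
proof -
  interpret prob_space \<mu> by (rule prob_space_\<mu>)
  \<comment> \<open>The function is \<open>1\<close> on one half of the interval and \<open>-1\<close> on the other.\<close>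
  have "rademacher N x * indicator (origin_interval N) x =
      2 * indicator (origin_interval (Suc N)) x - indicator (origin_interval N) x" for x
    by (auto simp: rademacher_def indicator_def dyadic_interval_def less_Suc_eq)
  then have "(\<integral>x. rademacher N x * indicator (origin_interval N) x \<partial>\<mu>) =
      (\<integral>x. 2 * indicator (origin_interval (Suc N)) x - indicator (origin_interval N) x \<partial>\<mu>)"
    by simp
  also have "\<dots> = 2 * measure \<mu> (origin_interval (Suc N)) - measure \<mu> (origin_interval N)"
    by (subst Bochner_Integration.integral_diff)
      (auto simp: emeasure_dyadic_interval space_\<mu> intro!: integrable_real_indicator)
  also have "\<dots> = 0" by (simp add: measure_dyadic_interval)
  finally show ?thesis .
qed

lemma integral_rademacher_atom: "(\<integral>x. rademacher_atom p N x \<partial>\<mu>) = 0"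
  by (simp add: rademacher_atom_def integral_rademacher_indicator)

lemma set_integral_rademacher_atom:
  assumes "origin_interval N \<subseteq> A"
  shows "(LINT y:A|\<mu>. rademacher_atom p N y) = 0"
proof -
  have "indicator A y *\<^sub>R rademacher_atom p N y = rademacher_atom p N y" for y
    using assms by (auto simp: rademacher_atom_def indicator_def)
  then show ?thesis
    by (simp only: set_lebesgue_integral_def integral_rademacher_atom)
qed

lemma p_atom_rademacher_atom:
  assumes "0 < p"
  shows "p_atom p (rademacher_atom p N)"
proof -
  let ?I = "origin_interval N"
  have norm: "measure \<mu> ?I powr (- 1 / p) = 2 powr (real N / p)"
  proof -
    have "measure \<mu> ?I = 2 powr (- real N)"
      by (simp add: measure_dyadic_interval power_one_over powr_minus_divide powr_realpow)
    then show ?thesis by (simp add: powr_powr)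
  qed
  have "bounded (range (rademacher_atom p N))"
    by (rule boundedI[where B = "2 powr (real N / p)"]) (auto simp: abs_rademacher_atom_le)
  moreover have "esssup \<mu> (\<lambda>y. ereal \<bar>rademacher_atom p N y\<bar>) \<le> ereal (measure \<mu> ?I powr (- 1 / p))"
    unfolding norm by (rule esssup_I) (auto simp: abs_rademacher_atom_le)
  moreover have "{y. rademacher_atom p N y \<noteq> 0} \<subseteq> ?I"
    by (auto simp: rademacher_atom_def indicator_def split: if_splits)
  ultimately show ?thesis
    unfolding p_atom_def Let_def
    by (intro conjI exI[of _ N] exI[of _ "\<lambda>_. 0"] set_integral_rademacher_atom
        rademacher_atom_measurable order_refl)
qed

section \<open>Quasi-norms\<close>

lemma ennpowr_mono:
  assumes "s \<le> t" and "0 < a"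
  shows "ennpowr s a \<le> ennpowr t a"
proof (cases "t = \<top>")
  case True
  then show ?thesis by (simp add: ennpowr_def)
next
  case False
  then have "t < \<top>" by (simp add: less_top)
  then have "enn2real s \<le> enn2real t" by (rule enn2real_mono[OF assms(1)])
  then have "enn2real s powr a \<le> enn2real t powr a"
    using assms(2) by (intro powr_mono2) auto
  moreover have "s \<noteq> \<top>" using assms(1) \<open>t < \<top>\<close> by auto
  ultimately show ?thesis
    using False by (simp add: ennpowr_def ennreal_leI)
qed

lemma ennpowr_ennreal: "0 \<le> r \<Longrightarrow> ennpowr (ennreal r) a = ennreal (r powr a)"
  by (simp add: ennpowr_def)

text \<open>On the support of the atom, an average never exceeds the supremum of its modulus.
  Off the support, a dyadic interval around the point either misses the support or, by nesting,
  contains it, and in the latter case the cancellation of the atom makes the average vanish.\<close>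

lemma martingale_max_rademacher_atom_le:
  "martingale_max (rademacher_atom p N) x
     \<le> ennreal (2 powr (real N / p) * indicator (origin_interval N) x)"
  unfolding martingale_max_def
proof (intro SUP_least ennreal_leI)
  fix n
  interpret prob_space \<mu> by (rule prob_space_\<mu>)
  let ?I = "dyadic_interval n x" and ?a = "rademacher_atom p N" and ?c = "2 powr (real N / p)"
  show "1 / measure \<mu> ?I * \<bar>LINT y:?I|\<mu>. ?a y\<bar> \<le> ?c * indicator (origin_interval N) x"
  proof (cases "x \<in> origin_interval N")
    case True
    have "\<bar>LINT y:?I|\<mu>. ?a y\<bar> \<le> (\<integral>y. norm (indicator ?I y *\<^sub>R ?a y) \<partial>\<mu>)"
      unfolding set_lebesgue_integral_def real_norm_def[symmetric] by (rule integral_norm_bound)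
    also have "\<dots> \<le> (\<integral>y. ?c * indicator ?I y \<partial>\<mu>)"
    proof (rule integral_mono)
      show "integrable \<mu> (\<lambda>y. norm (indicator ?I y *\<^sub>R ?a y))"
        by (rule integrable_const_bound[where B = ?c])
          (auto simp: indicator_def abs_rademacher_atom_le)
      show "integrable \<mu> (\<lambda>y. ?c * indicator ?I y)"
        by (rule integrable_const_bound[where B = ?c]) (auto simp: indicator_def)
    qed (auto simp: indicator_def abs_rademacher_atom_le)
    also have "\<dots> = ?c * measure \<mu> ?I" by (simp add: space_\<mu>)
    finally show ?thesis
      using True by (simp add: measure_dyadic_interval field_simps)
  next
    case False
    have "(LINT y:?I|\<mu>. ?a y) = 0"
    proof (cases "?I \<inter> origin_interval N = {}")
      case True
      then have "indicator ?I y *\<^sub>R ?a y = 0" for y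
        by (auto simp: rademacher_atom_def indicator_def)
      then show ?thesis by (simp only: set_lebesgue_integral_def Bochner_Integration.integral_zero)
    next
      case meet: False
      then obtain y where y: "\<forall>k<n. y k = x k" "\<forall>k<N. y k = 0"
        by (auto simp: dyadic_interval_def)
      obtain k where "k < N" "x k \<noteq> 0"
        using False by (auto simp: dyadic_interval_def)
      then have "\<not> k < n" using y by metis
      then have "n \<le> N" using \<open>k < N\<close> by simp
      then have "origin_interval N \<subseteq> ?I"
        using y by (force simp: dyadic_interval_def)
      then show ?thesis by (rule set_integral_rademacher_atom)
    qed
    then show ?thesis by simp
  qed
qed

lemma Hp_norm_rademacher_atom_le:
  assumes "0 < p"
  shows "Hp_norm p (rademacher_atom p N) \<le> 1"
proof -
  have "(\<integral>\<^sup>+x. ennpowr (martingale_max (rademacher_atom p N) x) p \<partial>\<mu>)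
      \<le> (\<integral>\<^sup>+x. ennreal (2 ^ N) * indicator (origin_interval N) x \<partial>\<mu>)"
  proof (rule nn_integral_mono)
    fix x
    have "ennpowr (martingale_max (rademacher_atom p N) x) p
        \<le> ennpowr (ennreal (2 powr (real N / p) * indicator (origin_interval N) x)) p"
      using assms by (intro ennpowr_mono martingale_max_rademacher_atom_le)
    also have "\<dots> = ennreal (2 ^ N) * indicator (origin_interval N) x"
      using assms by (auto simp: indicator_def ennpowr_ennreal powr_powr powr_realpow ennpowr_def)
    finally show "ennpowr (martingale_max (rademacher_atom p N) x) p
        \<le> ennreal (2 ^ N) * indicator (origin_interval N) x" .
  qed
  also have "\<dots> = ennreal (2 ^ N) * ennreal ((1 / 2) ^ N)"
    by (subst nn_integral_cmult_indicator) (auto simp: emeasure_dyadic_interval)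
  also have "\<dots> = ennreal 1"
    by (subst ennreal_mult[symmetric]) (auto simp flip: power_mult_distrib)
  finally have "Hp_norm p (rademacher_atom p N) \<le> ennpowr (ennreal 1) (1 / p)"
    unfolding Hp_norm_def Lp_norm_def using assms by (intro ennpowr_mono) auto
  then show ?thesis by (simp add: ennpowr_ennreal flip: ennreal_1 del: ennreal_1)
qed

text \<open>This turns the bound on the Hardy quasi-norm into a lower bound for the quotients. It
  includes a vanishing denominator, whose inverse is \<open>\<infinity>\<close>.\<close>

lemma le_divide_of_le_1:
  fixes a b :: ennreal
  assumes "b \<le> 1"
  shows "a \<le> a / b"
proof -
  have "1 \<le> inverse b"
  proof (cases b)
    case (real r)
    with assms show ?thesis
      by (cases "r = 0") (auto simp: inverse_ennreal ennreal_le_1 ennreal_ge_1 one_le_inverse_iff)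
  next
    case top
    with assms show ?thesis by (simp add: top_unique)
  qed
  then have "a * 1 \<le> a * inverse b" by (intro mult_left_mono) auto
  then show ?thesis by (simp add: divide_ennreal_def)
qed

section \<open>Partial sums\<close>

text \<open>Low Walsh functions are constant on the support of the atom, which has mean zero.\<close>

lemma walsh_coeff_rademacher_atom_low:
  assumes "k < 2 ^ N"
  shows "walsh_coeff (rademacher_atom p N) k = 0"
proof -
  have "rademacher_atom p N x * walsh k x = rademacher_atom p N x" for x
    using walsh_eq_1[OF assms, of x] by (auto simp: rademacher_atom_def indicator_def)
  then show ?thesis by (simp only: walsh_coeff_def integral_rademacher_atom)
qed

text \<open>On the support of the atom, \<open>w\<^sub>k\<close> with \<open>k = 2\<^sup>N + j\<close> reduces to \<open>r\<^sub>N\<close>, which squares to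
  \<open>1\<close> against the factor \<open>r\<^sub>N\<close> of the atom.\<close>

lemma walsh_coeff_rademacher_atom_high:
  assumes "j < 2 ^ N"
  shows "walsh_coeff (rademacher_atom p N) (2 ^ N + j) = 2 powr (real N / p) / 2 ^ N"
proof -
  have "rademacher_atom p N x * walsh (2 ^ N + j) x =
      2 powr (real N / p) * indicator (origin_interval N) x" for x
    using walsh_eq_1[OF assms, of x]
    by (auto simp: rademacher_atom_def indicator_def walsh_exp_add[OF assms] rademacher_def)
  then show ?thesis
    by (simp add: walsh_coeff_def space_\<mu> measure_dyadic_interval power_one_over)
qed

lemma sum_lessThan_add:
  fixes g :: "nat \<Rightarrow> 'a :: comm_monoid_add"
  shows "(\<Sum>k<m + n. g k) = (\<Sum>k<m. g k) + (\<Sum>j<n. g (m + j))"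
  by (induction n) (simp_all add: add.assoc)

text \<open>Only the last \<open>2\<^sup>s\<close> terms of the sum survive. They have equal coefficients, and at
  points of the interval of rank \<open>s\<close> also equal Walsh factors \<open>r\<^sub>N\<close>, so nothing cancels.\<close>

lemma abs_walsh_sum_rademacher_atom:
  assumes "s < N" and "x \<in> origin_interval s"
  shows "\<bar>walsh_sum (2 ^ N + 2 ^ s) (rademacher_atom p N) x\<bar> = 2 powr (real N / p) / 2 ^ N * 2 ^ s"
proof -
  let ?c = "walsh_coeff (rademacher_atom p N)"
  have "walsh_sum (2 ^ N + 2 ^ s) (rademacher_atom p N) x =
      (\<Sum>k<2 ^ N. ?c k * walsh k x) + (\<Sum>j<2 ^ s. ?c (2 ^ N + j) * walsh (2 ^ N + j) x)"
    unfolding walsh_sum_def by (rule sum_lessThan_add)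
  also have "(\<Sum>k<2 ^ N. ?c k * walsh k x) = 0"
    by (simp add: walsh_coeff_rademacher_atom_low)
  also have "(\<Sum>j<2 ^ s. ?c (2 ^ N + j) * walsh (2 ^ N + j) x) =
      (\<Sum>j<2 ^ s :: nat. 2 powr (real N / p) / 2 ^ N * rademacher N x)"
  proof (rule sum.cong)
    fix j :: nat assume "j \<in> {..<2 ^ s}"
    then have "j < 2 ^ s" by simp
    moreover have "(2 :: nat) ^ s < 2 ^ N" using assms(1) by simp
    ultimately have "j < 2 ^ N" by linarith
    then show "?c (2 ^ N + j) * walsh (2 ^ N + j) x = 2 powr (real N / p) / 2 ^ N * rademacher N x"
      using walsh_eq_1[OF \<open>j < 2 ^ s\<close> assms(2)]
      by (simp add: walsh_coeff_rademacher_atom_high walsh_exp_add)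
  qed simp
  finally show ?thesis by (simp add: abs_mult)
qed

section \<open>The weighted maximal operator\<close>

text \<open>The index \<open>2\<^sup>N + 2\<^sup>s\<close> is the witness: the exponent \<open>N/p - N + s\<close> of the partial sum,
  reduced by that of the weight \<open>(N - s)(1/p - 1)\<close>, is \<open>s/p\<close>, whatever \<open>N\<close> is.\<close>

lemma weighted_max_rademacher_atom_ge:
  assumes "0 < p" and "s < N" and "x \<in> origin_interval s"
  shows "ennreal (2 powr (real s / p)) \<le> weighted_max p (rademacher_atom p N) x"
proof -
  let ?n = "2 ^ N + 2 ^ s :: nat"
  have "\<bar>walsh_sum ?n (rademacher_atom p N) x\<bar> / 2 powr (real (\<rho> ?n) * (1 / p - 1))
      = 2 powr (real N / p - real N + real s - real (N - s) * (1 / p - 1))"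
    unfolding abs_walsh_sum_rademacher_atom[OF assms(2,3)] \<rho>_exp_add_exp[OF assms(2)]
    by (simp add: powr_diff powr_add powr_realpow)
  also have "real N / p - real N + real s - real (N - s) * (1 / p - 1) = real s / p"
    using assms by (simp add: of_nat_diff field_simps)
  finally show ?thesis
    unfolding weighted_max_def by (intro SUP_upper2[of ?n]) (auto simp: Suc_le_eq)
qed

text \<open>The lower bound \<open>2\<^bsup>s/p\<^esup>\<close> has exactly the size for which all scales \<open>s < N\<close>
  contribute equally to the integral of the \<open>p\<close>-th power. Restricting the bound of scale \<open>s\<close>
  to the ring of measure \<open>2\<^bsup>-s-1\<^esup>\<close> makes the contributions disjoint, so that they add up.\<close>

lemma Lp_norm_weighted_max_ge:
  assumes "0 < p"
  shows "ennreal ((real N / 2) powr (1 / p)) \<le> Lp_norm p (weighted_max p (rademacher_atom p N))"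
proof -
  interpret prob_space \<mu> by (rule prob_space_\<mu>)
  let ?R = "\<lambda>s. origin_interval s - origin_interval (Suc s)"
  have ring: "ennreal (2 ^ s) * emeasure \<mu> (?R s) = ennreal (1 / 2)" for s
  proof -
    have "emeasure \<mu> (?R s) = ennreal ((1 / 2) ^ s) - ennreal ((1 / 2) ^ Suc s)"
      by (subst emeasure_Diff) (auto simp: emeasure_dyadic_interval origin_interval_antimono)
    also have "\<dots> = ennreal ((1 / 2) ^ Suc s)"
      by (subst ennreal_minus) auto
    finally show ?thesis
      by (simp add: power_one_over flip: ennreal_mult')
  qed
  have "ennreal (real N / 2) = (\<Sum>s<N. ennreal (2 ^ s) * emeasure \<mu> (?R s))"
    unfolding ring by (subst sum_ennreal) auto
  also have "\<dots> = (\<integral>\<^sup>+x. (\<Sum>s<N. ennreal (2 ^ s) * indicator (?R s) x) \<partial>\<mu>)"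
    by (subst nn_integral_sum) (auto simp: nn_integral_cmult_indicator)
  also have "\<dots> \<le> (\<integral>\<^sup>+x. ennpowr (weighted_max p (rademacher_atom p N) x) p \<partial>\<mu>)"
  proof (rule nn_integral_mono)
    fix x
    show "(\<Sum>s<N. ennreal (2 ^ s) * indicator (?R s) x)
        \<le> ennpowr (weighted_max p (rademacher_atom p N) x) p"
    proof (cases "\<exists>s<N. x \<in> ?R s")
      case True
      then obtain s where s: "s < N" "x \<in> ?R s" by blast
      \<comment> \<open>The rings are disjoint, so the sum has a single nonzero term.\<close>
      have "x \<notin> ?R t" if "t \<noteq> s" for t
        using s(2) that origin_interval_antimono[of "Suc s" t] origin_interval_antimono[of "Suc t" s]
        by (cases "s < t") auto
      then have "(\<Sum>s<N. ennreal (2 ^ s) * indicator (?R s) x) =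
          (\<Sum>t<N. if t = s then ennreal (2 ^ s) else 0)"
        using s(2) by (intro sum.cong) auto
      also have "\<dots> = ennpowr (ennreal (2 powr (real s / p))) p"
        using s(1) assms by (simp add: ennpowr_ennreal powr_powr powr_realpow)
      also have "\<dots> \<le> ennpowr (weighted_max p (rademacher_atom p N) x) p"
        using s assms by (intro ennpowr_mono weighted_max_rademacher_atom_ge) auto
      finally show ?thesis .
    next
      case False
      then have "(\<Sum>s<N. ennreal (2 ^ s) * indicator (?R s) x) = 0"
        by (intro sum.neutral) (auto simp: indicator_def)
      then show ?thesis by simp
    qed
  qed
  finally have "ennpowr (ennreal (real N / 2)) (1 / p)
      \<le> Lp_norm p (weighted_max p (rademacher_atom p N))"
    unfolding Lp_norm_def using assms by (intro ennpowr_mono) auto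
  then show ?thesis by (simp add: ennpowr_ennreal)
qed

section \<open>Nondecreasing weights\<close>

text \<open>The superlevel set at a single level already bounds the weak quasi-norm below. As only
  strict superlevel sets enter its definition, the level is \<open>c / 2\<close> in place of \<open>c\<close>; the lost
  factor \<open>2\<close> is harmless for divergence.\<close>

lemma weak_Lp_norm_ge:
  assumes "0 < p" and "0 < c" and "A \<in> sets \<mu>" and [measurable]: "g \<in> borel_measurable \<mu>"
    and "\<And>x. x \<in> A \<Longrightarrow> ennreal c \<le> g x"
  shows "ennreal (c / 2 * measure \<mu> A powr (1 / p)) \<le> weak_Lp_norm p g"
proof -
  interpret prob_space \<mu> by (rule prob_space_\<mu>)
  have "A \<subseteq> {x \<in> space \<mu>. g x > ennreal (c / 2)}"
  proof
    fix x assume "x \<in> A"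
    have "ennreal (c / 2) < ennreal c"
      using assms(2) by (intro ennreal_lessI) auto
    also have "\<dots> \<le> g x" using assms(5) \<open>x \<in> A\<close> by blast
    finally show "x \<in> {x \<in> space \<mu>. g x > ennreal (c / 2)}" by (simp add: space_\<mu>)
  qed
  then have "emeasure \<mu> A \<le> emeasure \<mu> {x \<in> space \<mu>. g x > ennreal (c / 2)}"
    by (rule emeasure_mono) measurable
  then have "ennreal ((c / 2) powr p * measure \<mu> A)
      \<le> ennreal ((c / 2) powr p) * emeasure \<mu> {x \<in> space \<mu>. g x > ennreal (c / 2)}"
    by (simp add: ennreal_mult emeasure_eq_measure mult_left_mono)
  also have "\<dots> \<le> (SUP l\<in>{0::real<..}. ennreal (l powr p) * emeasure \<mu> {x \<in> space \<mu>. g x > ennreal l})"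
    using assms(2) by (intro SUP_upper) auto
  finally have "ennpowr (ennreal ((c / 2) powr p * measure \<mu> A)) (1 / p) \<le> weak_Lp_norm p g"
    unfolding weak_Lp_norm_def using assms(1) by (intro ennpowr_mono) auto
  then show ?thesis
    using assms(1,2) by (simp add: ennpowr_ennreal powr_mult powr_powr)
qed

text \<open>The term of index \<open>2\<^sup>N + 2\<^sup>s\<close> in the supremum has the constant modulus
  \<open>2\<^bsup>N/p - N + s\<^esup> / \<phi> (2\<^sup>N + 2\<^sup>s)\<close> on an interval of measure \<open>2\<^bsup>-s\<^esup>\<close>, and
  \<open>N/p - N + s - s/p = (N - s)(1/p - 1)\<close>.\<close>

lemma weak_Lp_norm_rademacher_atom_ge:
  assumes "0 < p" and "s < N" and "\<And>k. 1 \<le> \<phi> k"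
  shows "ennreal (2 powr (real (N - s) * (1 / p - 1)) / \<phi> (2 ^ N + 2 ^ s) / 2)
      \<le> weak_Lp_norm p (\<lambda>x. SUP k. ennreal (\<bar>walsh_sum k (rademacher_atom p N) x\<bar> / \<phi> k))"
proof -
  let ?n = "2 ^ N + 2 ^ s :: nat"
  let ?c = "2 powr (real N / p) / 2 ^ N * 2 ^ s / \<phi> ?n"
  have pos: "0 < \<phi> ?n" using assms(3)[of ?n] by linarith
  have "ennreal (?c / 2 * measure \<mu> (origin_interval s) powr (1 / p))
      \<le> weak_Lp_norm p (\<lambda>x. SUP k. ennreal (\<bar>walsh_sum k (rademacher_atom p N) x\<bar> / \<phi> k))"
  proof (rule weak_Lp_norm_ge)
    fix x assume x: "x \<in> origin_interval s"
    show "ennreal ?c \<le> (SUP k. ennreal (\<bar>walsh_sum k (rademacher_atom p N) x\<bar> / \<phi> k))"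
      by (rule SUP_upper2[of ?n])
        (simp_all only: abs_walsh_sum_rademacher_atom[OF assms(2) x] UNIV_I order_refl)
  qed (use assms pos in auto)
  also have "?c / 2 * measure \<mu> (origin_interval s) powr (1 / p) =
      2 powr (real N / p - real N + real s - real s / p) / \<phi> ?n / 2"
    by (simp add: measure_dyadic_interval power_one_over powr_diff powr_add powr_divide powr_powr
        flip: powr_realpow)
  also have "real N / p - real N + real s - real s / p = real (N - s) * (1 / p - 1)"
    using assms by (simp add: of_nat_diff field_simps)
  finally show ?thesis .
qed

text \<open>Thinning out the digits of \<open>n\<close> keeps the numerator and, by monotonicity, does not
  increase the denominator. The bound \<open>1 \<le> B\<close> forces \<open>\<rho> n > 0\<close>, so that the highest and the
  lowest digit are different.\<close>

lemma exists_exp_add_exp_large_ratio: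
  assumes "\<And>n. 1 \<le> \<phi> n" and "mono \<phi>"
    and "limsup (\<lambda>n. ereal (2 powr (real (\<rho> n) * c) / \<phi> n)) = \<infinity>" and "1 \<le> B"
  shows "\<exists>N s. s < N \<and> B < 2 powr (real (N - s) * c) / \<phi> (2 ^ N + 2 ^ s)"
proof -
  let ?r = "\<lambda>n. 2 powr (real (\<rho> n) * c) / \<phi> n"
  have "\<exists>n>0. B < ?r n"
  proof (rule ccontr)
    assume none: "\<not> (\<exists>n>0. B < ?r n)"
    \<comment> \<open>The index \<open>0\<close> has no binary digits, hence no meaningful \<open>\<rho>\<close>, and is left out.\<close>
    have "\<forall>\<^sub>F n in sequentially. ereal (?r n) \<le> ereal B"
    proof (rule eventually_sequentiallyI[of 1])
      fix n :: nat assume "1 \<le> n"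
      then have "0 < n" by simp
      with none have "\<not> B < ?r n" by blast
      then show "ereal (?r n) \<le> ereal B" by (simp only: ereal_less_eq not_less)
    qed
    then have "limsup (\<lambda>n. ereal (?r n)) \<le> ereal B" by (rule Limsup_bounded)
    then show False using assms(3) by simp
  qed
  then obtain n where n: "0 < n" "B < ?r n" by blast
  have pos: "0 < \<phi> k" for k using assms(1)[of k] by linarith
  have "\<rho> n \<noteq> 0"
  proof
    assume "\<rho> n = 0"
    then have "?r n \<le> 1" using assms(1)[of n] by simp
    then show False using n(2) assms(4) by linarith
  qed
  then have "0 < \<rho> n" by simp
  note ext = extreme_bits_le[OF this n(1)]
  let ?N = "highest_bit n" and ?s = "lowest_bit n"
  have "?r n \<le> 2 powr (real (\<rho> n) * c) / \<phi> (2 ^ ?N + 2 ^ ?s)"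
    using pos monoD[OF assms(2) ext(2)] by (intro divide_left_mono) auto
  then show ?thesis
    using n(2) ext(1) by (intro exI[of _ ?N] exI[of _ ?s]) (auto simp: \<rho>_def)
qed

lemma SUP_ennreal_eq_infinity:
  fixes h :: "nat \<Rightarrow> ennreal"
  assumes "\<And>M :: nat. \<exists>n. of_nat M \<le> h n"
  shows "(SUP n. h n) = \<infinity>"
  using assms by (simp add: infinity_ennreal_def ennreal_SUP_eq_top)

theorem theorem2:
  fixes p :: real
  assumes "0 < p" and "p < 1"
  shows "(\<exists>f :: nat \<Rightarrow> G \<Rightarrow> real. (\<forall>n. p_atom p (f n)) \<and>
            (SUP n. Lp_norm p (weighted_max p (f n)) / Hp_norm p (f n)) = \<infinity>) \<and>
         (\<forall>\<phi> :: nat \<Rightarrow> real. (\<forall>n. 1 \<le> \<phi> n) \<longrightarrow> mono \<phi> \<longrightarrow>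
            limsup (\<lambda>n. ereal (2 powr (real (\<rho> n) * (1 / p - 1)) / \<phi> n)) = \<infinity> \<longrightarrow>
            (\<exists>f :: nat \<Rightarrow> G \<Rightarrow> real. (\<forall>n. p_atom p (f n)) \<and>
               (SUP n. weak_Lp_norm p (\<lambda>x. SUP k. ennreal (\<bar>walsh_sum k (f n) x\<bar> / \<phi> k))
                        / Hp_norm p (f n)) = \<infinity>))"
proof (intro conjI allI impI)
  show "\<exists>f :: nat \<Rightarrow> G \<Rightarrow> real. (\<forall>n. p_atom p (f n)) \<and>
      (SUP n. Lp_norm p (weighted_max p (f n)) / Hp_norm p (f n)) = \<infinity>"
  proof (intro exI[of _ "rademacher_atom p"] conjI allI)
    show "(SUP n. Lp_norm p (weighted_max p (rademacher_atom p n)) / Hp_norm p (rademacher_atom p n)) = \<infinity>"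
    proof (rule SUP_ennreal_eq_infinity)
      fix M :: nat
      \<comment> \<open>The base \<open>?N / 2\<close> is at least \<open>1\<close>, so the exponent \<open>1 / p > 1\<close> can only increase it.\<close>
      let ?N = "2 * Suc M"
      have "real (Suc M) powr 1 \<le> real (Suc M) powr (1 / p)"
        using assms by (intro powr_mono) auto
      then have "real M \<le> (real ?N / 2) powr (1 / p)" by (simp add: add_divide_distrib)
      then have "of_nat M \<le> ennreal ((real ?N / 2) powr (1 / p))"
        by (simp only: ennreal_of_nat_eq_real_of_nat ennreal_leI)
      also have "\<dots> \<le> Lp_norm p (weighted_max p (rademacher_atom p ?N))"
        by (rule Lp_norm_weighted_max_ge[OF assms(1)])
      also have "\<dots> \<le> \<dots> / Hp_norm p (rademacher_atom p ?N)"
        by (intro le_divide_of_le_1 Hp_norm_rademacher_atom_le assms(1))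
      finally show "\<exists>n. of_nat M
          \<le> Lp_norm p (weighted_max p (rademacher_atom p n)) / Hp_norm p (rademacher_atom p n)"
        by blast
    qed
  qed (rule p_atom_rademacher_atom[OF assms(1)])
next
  fix \<phi> :: "nat \<Rightarrow> real"
  assume \<phi>: "\<forall>n. 1 \<le> \<phi> n" "mono \<phi>"
    and limsup: "limsup (\<lambda>n. ereal (2 powr (real (\<rho> n) * (1 / p - 1)) / \<phi> n)) = \<infinity>"
  let ?h = "\<lambda>N. weak_Lp_norm p (\<lambda>x. SUP k. ennreal (\<bar>walsh_sum k (rademacher_atom p N) x\<bar> / \<phi> k))
      / Hp_norm p (rademacher_atom p N)"
  show "\<exists>f :: nat \<Rightarrow> G \<Rightarrow> real. (\<forall>n. p_atom p (f n)) \<and>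
      (SUP n. weak_Lp_norm p (\<lambda>x. SUP k. ennreal (\<bar>walsh_sum k (f n) x\<bar> / \<phi> k))
         / Hp_norm p (f n)) = \<infinity>"
  proof (intro exI[of _ "rademacher_atom p"] conjI allI)
    show "(SUP N. ?h N) = \<infinity>"
    proof (rule SUP_ennreal_eq_infinity)
      fix M :: nat
      obtain N s where Ns: "s < N"
        "real (2 * M + 1) < 2 powr (real (N - s) * (1 / p - 1)) / \<phi> (2 ^ N + 2 ^ s)"
        using exists_exp_add_exp_large_ratio[OF _ \<phi>(2) limsup, of "real (2 * M + 1)"] \<phi>(1) by auto
      have "of_nat M \<le> ennreal (2 powr (real (N - s) * (1 / p - 1)) / \<phi> (2 ^ N + 2 ^ s) / 2)"
        unfolding ennreal_of_nat_eq_real_of_nat using Ns(2) by (intro ennreal_leI) simp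
      also have "\<dots> \<le> weak_Lp_norm p (\<lambda>x. SUP k. ennreal (\<bar>walsh_sum k (rademacher_atom p N) x\<bar> / \<phi> k))"
        using \<phi>(1) by (intro weak_Lp_norm_rademacher_atom_ge assms(1) Ns(1)) auto
      also have "\<dots> \<le> ?h N"
        by (intro le_divide_of_le_1 Hp_norm_rademacher_atom_le assms(1))
      finally show "\<exists>N. of_nat M \<le> ?h N" by blast
    qed
  qed (rule p_atom_rademacher_atom[OF assms(1)])
qed

end
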